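(* The problem $\textsc{RotDist}$ many-one reduces in polynomial time to the problem $\textsc{RotDist}_H$. Here $\textsc{RotDist}$ is the problem: given two full binary trees $T_1,T_2$ with the same number of internal nodes and an integer $k$, decide whether $d(T_1,T_2)\le k$. And $\textsc{RotDist}_H$ is the problem: given integers $h,k$ and two full binary trees $T_1,T_2$ with the same number of internal nodes, each of height at most $h$, decide whether $d_H(T_1,T_2)\le k$.
   Context: A full binary tree is a rooted ordered tree in which every node is either a leaf or an internal node with exactly two children. A right rotation at an internal node $a$ whose left child $b$ is internal, where $C,D$ are the left and right subtrees of $b$ and $E$ is the right subtree of $a$, replaces the subtree rooted at $a$ by the tree with root $b$, left subtree $C$, and right child $a$ whose left and right subtrees are $D$ and $E$; a left rotation is the symmetric (inverse) operation. The rotation distance $d(T_1,T_2)$ is the minimum number of rotations transforming $T_1$ into $T_2$. The height of a full binary tree is the number of internal nodes on a longest root-to-leaf path. For trees $T_1,T_2$ of height at most $h$, the height-bounded rotation distance $d_H(T_1,T_2)$ is the minimum length of a sequence of rotations transforming $T_1$ into $T_2$ such that every intermediate tree has height at most $h$. *)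

theory Defs
  imports
    "HOL-Library.Tree"
    "HOL-Library.Extended_Nat"
    "HOL-Computational_Algebra.Polynomial"
begin

section \<open>Deterministic multitape Turing machines\<close>

text \<open>
  Tapes are infinite in both directions. \<open>Sym\<close> embeds the alphabet over which inputs and
  outputs are written; \<open>Aux i\<close> are the further tape symbols of a machine.
\<close>

datatype 'a cell = Blank | Sym 'a | Aux nat

datatype direction = Leftward | Stay | Rightward

fun offset :: "direction \<Rightarrow> int" where
  "offset Leftward = -1"
| "offset Stay = 0"
| "offset Rightward = 1"

text \<open>
  The states are \<open>{0..states M}\<close>, with initial state \<open>0\<close> and halting state \<open>states M\<close>.
  The transition function maps a state and the list of symbols under the heads to the next state
  and, for each tape, the symbol to write and the direction in which the head moves.
\<close>

record 'a tm =
  tapes :: nat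
  states :: nat
  auxs :: nat
  delta :: "nat \<Rightarrow> 'a cell list \<Rightarrow> nat \<times> ('a cell \<times> direction) list"

definition tape_alphabet :: "'a tm \<Rightarrow> 'a cell set" where
  "tape_alphabet M = {Blank} \<union> range Sym \<union> Aux ` {..<auxs M}"

definition wf_tm :: "'a::finite tm \<Rightarrow> bool" where
  "wf_tm M \<longleftrightarrow> 1 \<le> tapes M \<and>
    (\<forall>q < states M. \<forall>cs. length cs = tapes M \<and> set cs \<subseteq> tape_alphabet M \<longrightarrow>
      (case delta M q cs of (q', acts) \<Rightarrow>
        q' \<le> states M \<and> length acts = tapes M \<and> fst ` set acts \<subseteq> tape_alphabet M))"

text \<open>A tape is given by the position of its head and by its contents.\<close>

type_synonym 'a tape = "int \<times> (int \<Rightarrow> 'a cell)"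
type_synonym 'a config = "nat \<times> 'a tape list"

fun read :: "'a tape \<Rightarrow> 'a cell" where
  "read (i, c) = c i"

fun act :: "'a cell \<times> direction \<Rightarrow> 'a tape \<Rightarrow> 'a tape" where
  "act (s, m) (i, c) = (i + offset m, c(i := s))"

fun step :: "'a tm \<Rightarrow> 'a config \<Rightarrow> 'a config" where
  "step M (q, ts) =
    (if q = states M then (q, ts)
     else case delta M q (map read ts) of (q', acts) \<Rightarrow> (q', map2 act acts ts))"

definition written :: "'a list \<Rightarrow> int \<Rightarrow> 'a cell" where
  "written w i = (if 0 \<le> i \<and> i < int (length w) then Sym (w ! nat i) else Blank)"

definition init :: "'a tm \<Rightarrow> 'a list \<Rightarrow> 'a config" where
  "init M w = (0, (0, written w) # replicate (tapes M - 1) (0, \<lambda>_. Blank))"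

text \<open>The input is placed on the first tape, and the output is read off the last one.\<close>

definition halts_with :: "'a tm \<Rightarrow> 'a list \<Rightarrow> nat \<Rightarrow> 'a list \<Rightarrow> bool" where
  "halts_with M w t v \<longleftrightarrow>
    (case (step M ^^ t) (init M w) of (q, ts) \<Rightarrow> q = states M \<and> snd (last ts) = written v)"

text \<open>A halted machine never changes its configuration, so \<open>t\<close> bounds the running time.\<close>

definition polytime_computable :: "('a::finite list \<Rightarrow> 'a list) \<Rightarrow> bool" where
  "polytime_computable f \<longleftrightarrow>
    (\<exists>M (p :: nat poly). wf_tm M \<and> (\<forall>w. \<exists>t \<le> poly p (length w). halts_with M w t (f w)))"

definition polytime_many_one_reducible :: "'a::finite list set \<Rightarrow> 'a list set \<Rightarrow> bool"
    (infix \<open>\<le>\<^sub>p\<close> 50) where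
  "A \<le>\<^sub>p B \<longleftrightarrow> (\<exists>f. polytime_computable f \<and> (\<forall>w. w \<in> A \<longleftrightarrow> f w \<in> B))"


section \<open>Full binary trees and rotation distance\<close>

text \<open>
  Children are ordered and only the shape matters, hence trees with trivial labels: \<open>Node\<close>
  is an internal node, \<open>size\<close> counts internal nodes, and \<open>height\<close> is the number of
  internal nodes on a longest root-to-leaf path.
\<close>

type_synonym full_tree = "unit tree"

inductive right_rotation :: "full_tree \<Rightarrow> full_tree \<Rightarrow> bool" where
  here: "right_rotation (Node (Node C () D) () E) (Node C () (Node D () E))"
| in_left: "right_rotation l l' \<Longrightarrow> right_rotation (Node l () r) (Node l' () r)"
| in_right: "right_rotation r r' \<Longrightarrow> right_rotation (Node l () r) (Node l () r')"

definition left_rotation :: "full_tree \<Rightarrow> full_tree \<Rightarrow> bool" where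
  "left_rotation T T' \<longleftrightarrow> right_rotation T' T"

definition rotation :: "full_tree \<Rightarrow> full_tree \<Rightarrow> bool" where
  "rotation T T' \<longleftrightarrow> right_rotation T T' \<or> left_rotation T T'"

text \<open>A sequence of \<open>n\<close> rotations is given by the \<open>n + 1\<close> trees that it visits.\<close>

definition rotation_sequence :: "full_tree \<Rightarrow> full_tree list \<Rightarrow> full_tree \<Rightarrow> bool" where
  "rotation_sequence T Ts T' \<longleftrightarrow>
    Ts \<noteq> [] \<and> hd Ts = T \<and> last Ts = T' \<and> successively rotation Ts"

text \<open>Both distances are \<open>\<infinity>\<close> if there is no admissible sequence.\<close>

definition rot_dist :: "full_tree \<Rightarrow> full_tree \<Rightarrow> enat" where
  "rot_dist T T' = Inf {enat (length Ts - 1) | Ts. rotation_sequence T Ts T'}"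

definition rot_dist_H :: "int \<Rightarrow> full_tree \<Rightarrow> full_tree \<Rightarrow> enat" where
  "rot_dist_H h T T' = Inf {enat (length Ts - 1) | Ts.
     rotation_sequence T Ts T' \<and> (\<forall>S \<in> set Ts. int (height S) \<le> h)}"


section \<open>The decision problems\<close>

text \<open>
  Instances are words over a four-letter alphabet: a tree is written in preorder, with one symbol
  for each node (internal or leaf), an integer in signed binary, most significant bit first.
  Words that do not encode an instance are not in the language.
\<close>

datatype symbol = Zero | One | Minus | Sep

instance symbol :: finite
proof
  have "(UNIV :: symbol set) = {Zero, One, Minus, Sep}"
    using symbol.exhaust by blast
  then show "finite (UNIV :: symbol set)"
    by (metis finite.emptyI finite_insert)
qed

fun enc_nat :: "nat \<Rightarrow> symbol list" where
  "enc_nat n = (if n < 2 then [] else enc_nat (n div 2)) @ [if odd n then One else Zero]"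

declare enc_nat.simps [simp del]

definition enc_int :: "int \<Rightarrow> symbol list" where
  "enc_int i = (if i < 0 then [Minus] else []) @ enc_nat (nat \<bar>i\<bar>)"

fun enc_tree :: "full_tree \<Rightarrow> symbol list" where
  "enc_tree Leaf = [Zero]"
| "enc_tree (Node l _ r) = One # enc_tree l @ enc_tree r"

definition RotDist :: "symbol list set" where
  "RotDist = {enc_tree T\<^sub>1 @ [Sep] @ enc_tree T\<^sub>2 @ [Sep] @ enc_int k | T\<^sub>1 T\<^sub>2 k.
     size T\<^sub>1 = size T\<^sub>2 \<and>
     0 \<le> k \<and> rot_dist T\<^sub>1 T\<^sub>2 \<le> enat (nat k)}"

definition RotDist_H :: "symbol list set" where
  "RotDist_H = {enc_int h @ [Sep] @ enc_tree T\<^sub>1 @ [Sep] @ enc_tree T\<^sub>2 @ [Sep] @ enc_int k | h T\<^sub>1 T\<^sub>2 k.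
     size T\<^sub>1 = size T\<^sub>2 \<and> int (height T\<^sub>1) \<le> h \<and> int (height T\<^sub>2) \<le> h \<and>
     0 \<le> k \<and> rot_dist_H h T\<^sub>1 T\<^sub>2 \<le> enat (nat k)}"

text \<open>An instance is determined by its encoding.\<close>

lemma enc_nat_rec: "2 \<le> n \<Longrightarrow> enc_nat n = enc_nat (n div 2) @ [if odd n then One else Zero]"
  by (subst enc_nat.simps) simp

lemma enc_nat_base: "enc_nat 0 = [Zero]" "enc_nat (Suc 0) = [One]"
  by (subst enc_nat.simps, simp)+

lemma enc_nat_nonempty: "enc_nat n \<noteq> []"
  by (subst enc_nat.simps) simp

lemma enc_nat_inject: "enc_nat m = enc_nat n \<Longrightarrow> m = n"
proof (induction m arbitrary: n rule: less_induct)
  case (less m)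
  consider "m < 2" "n < 2" | "m < 2" "2 \<le> n" | "2 \<le> m" "n < 2" | "2 \<le> m" "2 \<le> n"
    by linarith
  then show ?case
  proof cases
    case 1
    then have "m = 0 \<or> m = Suc 0" "n = 0 \<or> n = Suc 0" by auto
    then show ?thesis
      using less.prems by (auto simp: enc_nat_base)
  next
    case 2
    then have "m = 0 \<or> m = Suc 0" by auto
    then show ?thesis
      using less.prems enc_nat_rec[OF 2(2)] enc_nat_nonempty[of "n div 2"]
      by (auto simp: enc_nat_base)
  next
    case 3
    then have "n = 0 \<or> n = Suc 0" by auto
    then show ?thesis
      using less.prems enc_nat_rec[OF 3(1)] enc_nat_nonempty[of "m div 2"]
      by (auto simp: enc_nat_base)
  next
    case 4
    have eq: "enc_nat (m div 2) = enc_nat (n div 2)" "odd m = odd n"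
      using less.prems unfolding enc_nat_rec[OF 4(1)] enc_nat_rec[OF 4(2)]
      by (auto split: if_splits)
    have "m div 2 = n div 2"
      by (rule less.IH) (use 4 eq in auto)
    with eq(2) show ?thesis
      by presburger
  qed
qed

lemma set_enc_nat: "set (enc_nat n) \<subseteq> {Zero, One}"
proof (induction n rule: less_induct)
  case (less n)
  show ?case
  proof (cases "n < 2")
    case True
    then have "n = 0 \<or> n = Suc 0" by auto
    then show ?thesis by (auto simp: enc_nat_base)
  next
    case False
    then show ?thesis
      using less.IH[of "n div 2"] by (simp add: enc_nat_rec)
  qed
qed

lemma enc_int_inject: "enc_int i = enc_int j \<Longrightarrow> i = j"
proof -
  assume eq: "enc_int i = enc_int j"
  have m: "Minus \<in> set (enc_int k) \<longleftrightarrow> k < 0" for k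
    using set_enc_nat[of "nat \<bar>k\<bar>"] by (auto simp: enc_int_def)
  have "i < 0 \<longleftrightarrow> j < 0"
    using m[of i] m[of j] eq by simp
  moreover from this have "nat \<bar>i\<bar> = nat \<bar>j\<bar>"
    using eq by (intro enc_nat_inject) (auto simp: enc_int_def split: if_splits)
  ultimately show "i = j"
    by (auto split: if_splits)
qed

lemma enc_tree_prefix: "enc_tree T @ u = enc_tree T' @ u' \<Longrightarrow> T = T' \<and> u = u'"
proof (induction T arbitrary: T' u u')
  case Leaf
  then show ?case by (cases T') simp_all
next
  case (Node l x r)
  obtain l' x' r' where T': "T' = Node l' x' r'"
    using Node.prems by (cases T') simp_all
  have "enc_tree l @ enc_tree r @ u = enc_tree l' @ enc_tree r' @ u'"
    using Node.prems T' by simp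
  from Node.IH(1)[OF this] have l: "l = l'" and r: "enc_tree r @ u = enc_tree r' @ u'"
    by simp_all
  from Node.IH(2)[OF r] l T' show ?case
    by simp
qed

lemma Sep_notin_enc_int: "Sep \<notin> set (enc_int i)"
  using set_enc_nat[of "nat \<bar>i\<bar>"] by (auto simp: enc_int_def)

lemma Sep_split:
  assumes "xs @ Sep # u = ys @ Sep # v" "Sep \<notin> set xs" "Sep \<notin> set ys"
  shows "xs = ys \<and> u = v"
  using assms
proof (induction xs arbitrary: ys)
  case Nil
  then show ?case by (cases ys) auto
next
  case (Cons x xs)
  then show ?case by (cases ys) auto
qed

lemma RotDist_encoding_inject:
  assumes "enc_tree S @ [Sep] @ enc_tree T @ [Sep] @ enc_int k =
    enc_tree S' @ [Sep] @ enc_tree T' @ [Sep] @ enc_int k'"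
  shows "S = S' \<and> T = T' \<and> k = k'"
proof -
  have 1: "S = S'" and "[Sep] @ enc_tree T @ [Sep] @ enc_int k = [Sep] @ enc_tree T' @ [Sep] @ enc_int k'"
    using enc_tree_prefix[OF assms] by auto
  then have "enc_tree T @ [Sep] @ enc_int k = enc_tree T' @ [Sep] @ enc_int k'"
    by simp
  from enc_tree_prefix[OF this] 1 show ?thesis
    by (auto dest: enc_int_inject)
qed

lemma RotDist_H_encoding_inject:
  assumes "enc_int h @ [Sep] @ enc_tree S @ [Sep] @ enc_tree T @ [Sep] @ enc_int k =
    enc_int h' @ [Sep] @ enc_tree S' @ [Sep] @ enc_tree T' @ [Sep] @ enc_int k'"
  shows "h = h' \<and> S = S' \<and> T = T' \<and> k = k'"
proof -
  have "enc_int h = enc_int h' \<and>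
    enc_tree S @ [Sep] @ enc_tree T @ [Sep] @ enc_int k =
    enc_tree S' @ [Sep] @ enc_tree T' @ [Sep] @ enc_int k'"
    by (rule Sep_split) (use assms in \<open>simp_all add: Sep_notin_enc_int\<close>)
  then show ?thesis
    by (meson RotDist_encoding_inject enc_int_inject)
qed

end

(* A tree with n internal nodes has height at most n, and rotations preserve n, so the height
   bound is void as soon as h \<ge> n. Hence it suffices to prefix an instance w by such an h. The
   choice h = 2 ^ length w - 1 has the binary encoding 1...1 with length w digits, so a
   two-tape machine can write it by passing once over w, without doing any arithmetic. *)

theory Submission
  imports Defs
begin

section \<open>Void height bounds\<close>

lemma size_right_rotation: "right_rotation T T' \<Longrightarrow> size T = size T'"
  by (induction rule: right_rotation.induct) auto

lemma size_rotation: "rotation T T' \<Longrightarrow> size T = size T'"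
  unfolding rotation_def left_rotation_def using size_right_rotation by metis

lemma size_successively_rotation:
  "successively rotation Ts \<Longrightarrow> S \<in> set Ts \<Longrightarrow> size S = size (hd Ts)"
  by (induction Ts rule: induct_list012) (auto simp: size_rotation)

text \<open>The infimum on the right ranges over fewer sequences. No bound on \<open>h\<close> is
  assumed, so this applies to an \<open>h\<close> obtained by decoding.\<close>

lemma rot_dist_le_rot_dist_H: "rot_dist T T' \<le> rot_dist_H h T T'"
  unfolding rot_dist_def rot_dist_H_def by (rule Inf_superset_mono) auto

lemma rot_dist_H_eq_rot_dist:
  assumes "int (size T) \<le> h"
  shows "rot_dist_H h T T' = rot_dist T T'"
proof -
  have "int (height S) \<le> h" if "rotation_sequence T Ts T'" "S \<in> set Ts" for Ts S
    using size_successively_rotation[of Ts S] height_le_size_tree[of S] that assms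
    by (auto simp: rotation_sequence_def)
  then have "rotation_sequence T Ts T' \<and> (\<forall>S \<in> set Ts. int (height S) \<le> h) \<longleftrightarrow>
      rotation_sequence T Ts T'" for Ts
    by blast
  then show ?thesis
    unfolding rot_dist_H_def rot_dist_def by simp
qed


section \<open>Correctness of the reduction\<close>

text \<open>Defined on all words, without testing whether \<open>w\<close> encodes an
  instance.\<close>

definition pad :: "symbol list \<Rightarrow> symbol list" where
  "pad w = replicate (length w) One @ [Sep] @ w"

text \<open>Appending the digit \<open>One\<close> sends m to 2m + 1, hence 2^n - 1 to 2^(n+1) - 1.
  The exponent starts at 1 because 0 is encoded as \<open>[Zero]\<close>, not as the empty
  word.\<close>

lemma enc_nat_power2_minus_1: "enc_nat (2 ^ Suc n - 1) = replicate (Suc n) One"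
proof (induction n)
  case 0
  then show ?case by (simp add: enc_nat_base)
next
  case (Suc n)
  have pos: "1 \<le> (2 :: nat) ^ n"
    by simp
  then have "2 \<le> (2 :: nat) ^ Suc (Suc n) - 1"
    unfolding power_Suc by linarith
  moreover have "(2 ^ Suc (Suc n) - 1) div 2 = (2 ^ Suc n - 1 :: nat)"
    using pos unfolding power_Suc by linarith
  moreover have "odd (2 ^ Suc (Suc n) - 1 :: nat)"
    by simp
  ultimately have "enc_nat (2 ^ Suc (Suc n) - 1) = enc_nat (2 ^ Suc n - 1) @ [One]"
    using enc_nat_rec[of "2 ^ Suc (Suc n) - 1"] by simp
  then show ?case
    unfolding Suc.IH by (simp add: replicate_append_same)
qed

lemma enc_int_power2_minus_1:
  assumes "0 < n"
  shows "enc_int (2 ^ n - 1) = replicate n One"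
proof -
  obtain m where n: "n = Suc m"
    using assms gr0_conv_Suc by blast
  have pos: "(1 :: int) \<le> 2 ^ n"
    by simp
  then have "nat \<bar>2 ^ n - 1 :: int\<bar> = 2 ^ n - 1"
    by (simp add: nat_diff_distrib nat_power_eq)
  moreover have "\<not> 2 ^ n - 1 < (0 :: int)"
    using pos by linarith
  ultimately have "enc_int (2 ^ n - 1) = enc_nat (2 ^ n - 1)"
    by (simp only: enc_int_def if_False append_Nil)
  then show ?thesis
    unfolding n enc_nat_power2_minus_1 .
qed

lemma length_enc_tree: "length (enc_tree T) = 2 * size T + 1"
  by (induction T) auto

lemma pad_in_RotDist_H:
  assumes "w \<in> RotDist"
  shows "pad w \<in> RotDist_H"
proof -
  obtain T T' k where w: "w = enc_tree T @ [Sep] @ enc_tree T' @ [Sep] @ enc_int k"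
    and size: "size T = size T'" and k: "0 \<le> k" "rot_dist T T' \<le> enat (nat k)"
    using assms unfolding RotDist_def by blast
  define h :: int where "h = 2 ^ length w - 1"
  \<comment> \<open>The preorder code of \<open>T\<close> alone already has 2 *
    \<open>size T\<close> + 1 symbols.\<close>
  have "size T < length w"
    by (simp add: w length_enc_tree)
  also have "length w < 2 ^ length w"
    by (rule less_exp)
  finally have "int (size T) < 2 ^ length w"
    by (metis of_nat_less_iff of_nat_numeral of_nat_power)
  then have h: "int (size T) \<le> h"
    by (simp add: h_def)
  moreover have "int (height T) \<le> h" "int (height T') \<le> h"
    using h size height_le_size_tree[of T] height_le_size_tree[of T'] by linarith+
  moreover have "pad w = enc_int h @ [Sep] @ enc_tree T @ [Sep] @ enc_tree T' @ [Sep] @ enc_int k"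
    unfolding pad_def h_def using enc_int_power2_minus_1[of "length w"] by (simp add: w)
  ultimately show ?thesis
    unfolding RotDist_H_def using size k rot_dist_H_eq_rot_dist[OF h, of T']
    by (smt (verit) mem_Collect_eq)
qed

text \<open>This also covers malformed words: whatever \<open>h\<close> the prefix encodes, the part
  after the first \<open>Sep\<close> is \<open>w\<close> and must itself encode an instance.\<close>

lemma in_RotDist_if_pad:
  assumes "pad w \<in> RotDist_H"
  shows "w \<in> RotDist"
proof -
  obtain h T T' k
    where eq: "pad w = enc_int h @ [Sep] @ enc_tree T @ [Sep] @ enc_tree T' @ [Sep] @ enc_int k"
      and size: "size T = size T'" and k: "0 \<le> k" "rot_dist_H h T T' \<le> enat (nat k)"
    using assms unfolding RotDist_H_def by blast
  have "w = enc_tree T @ [Sep] @ enc_tree T' @ [Sep] @ enc_int k"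
    \<comment> \<open>Neither prefix contains \<open>Sep\<close>, so both words are cut at their
      first \<open>Sep\<close>.\<close>
    using Sep_split[of "replicate (length w) One" w "enc_int h"] eq Sep_notin_enc_int
    by (simp add: pad_def)
  moreover have "rot_dist T T' \<le> enat (nat k)"
    using rot_dist_le_rot_dist_H k(2) by (rule order_trans)
  ultimately show ?thesis
    unfolding RotDist_def using size k(1) by blast
qed


section \<open>A machine for the reduction\<close>

text \<open>
  State 0 writes one \<open>One\<close> for each input symbol and then \<open>Sep\<close>, state 1 rewinds the input tape,
  and state 2 copies the input.
\<close>

definition pad_delta :: "nat \<Rightarrow> symbol cell list \<Rightarrow> nat \<times> (symbol cell \<times> direction) list" where
  "pad_delta q cs =
    (if q = 0 then
       (case hd cs of
          Sym x \<Rightarrow> (0, [(Sym x, Rightward), (Sym One, Rightward)])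
        | _ \<Rightarrow> (1, [(Blank, Leftward), (Sym Sep, Rightward)]))
     else if q = 1 then
       (case hd cs of
          Sym x \<Rightarrow> (1, [(Sym x, Leftward), (Blank, Stay)])
        | _ \<Rightarrow> (2, [(Blank, Rightward), (Blank, Stay)]))
     else
       (case hd cs of
          Sym x \<Rightarrow> (2, [(Sym x, Rightward), (Sym x, Rightward)])
        | _ \<Rightarrow> (3, [(Blank, Stay), (Blank, Stay)])))"

definition pad_tm :: "symbol tm" where
  "pad_tm = \<lparr>tapes = 2, states = 3, auxs = 0, delta = pad_delta\<rparr>"

lemma wf_pad_tm: "wf_tm pad_tm"
  unfolding wf_tm_def
  by (auto simp: pad_tm_def pad_delta_def tape_alphabet_def split: cell.split)

text \<open>Keeps the output tape in the form \<open>written _\<close> while its head stands on the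
  first blank after the word.\<close>

lemma written_append_single: "(written v)(int (length v) := Sym x) = written (v @ [x])"
  by (auto simp: written_def nth_append fun_eq_iff)

lemma written_nth: "i < length w \<Longrightarrow> written w (int i) = Sym (w ! i)"
  by (simp add: written_def)

lemma written_length: "written w (int (length w)) = Blank"
  by (simp add: written_def)

lemma written_minus_1: "written w (-1) = Blank"
  by (simp add: written_def)

text \<open>Each transition must write on every tape; rewriting the symbol just read leaves the
  contents unchanged.\<close>

lemma fun_upd_same: "f x = y \<Longrightarrow> f(x := y) = f"
  by auto

lemma pad_tm_ones:
  "i \<le> length w \<Longrightarrow> (step pad_tm ^^ i) (init pad_tm w) =
    (0, [(int i, written w), (int i, written (replicate i One))])"
proof (induction i)
  case 0
  then show ?case
    by (auto simp: init_def pad_tm_def written_def)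
next
  case (Suc i)
  then show ?case
    using written_append_single[of "replicate i One" One]
    by (simp add: pad_tm_def pad_delta_def written_nth fun_upd_same replicate_append_same)
qed

text \<open>The extra step reads the blank after \<open>w\<close>. For empty \<open>w\<close> the
  input head ends at -1, where rewinding is already complete.\<close>

lemma pad_tm_Sep:
  "(step pad_tm ^^ Suc (length w)) (init pad_tm w) =
    (1, [(int (length w) - 1, written w),
      (int (Suc (length w)), written (replicate (length w) One @ [Sep]))])"
  using pad_tm_ones[of "length w" w] written_append_single[of "replicate (length w) One" Sep]
  by (simp add: pad_tm_def pad_delta_def written_length fun_upd_same)

text \<open>State 1 writes \<open>Blank\<close> under the resting output head, which is harmless
  exactly because that cell is blank.\<close>

lemma pad_tm_rewind:
  assumes "c p = Blank"
  shows "i \<le> length w \<Longrightarrow>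
    (step pad_tm ^^ i) (1, [(int (length w) - 1, written w), (p, c)]) =
      (1, [(int (length w) - 1 - int i, written w), (p, c)])"
proof (induction i)
  case (Suc i)
  have "int (length w) - 1 - int i = int (length w - Suc i)"
    using Suc.prems by simp
  then have "written w (int (length w) - 1 - int i) = Sym (w ! (length w - Suc i))"
    using Suc.prems by (simp only: written_nth)
  with Suc assms show ?case
    by (simp add: pad_tm_def pad_delta_def fun_upd_same)
qed simp

text \<open>The last step reads the blank at -1, which marks the left end of the input, and returns
  the head to 0.\<close>

lemma pad_tm_rewound:
  assumes "c p = Blank"
  shows "(step pad_tm ^^ Suc (length w)) (1, [(int (length w) - 1, written w), (p, c)]) =
    (2, [(0, written w), (p, c)])"
  using pad_tm_rewind[of c p "length w" w] assms
  by (simp add: pad_tm_def pad_delta_def written_minus_1 fun_upd_same)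

lemma pad_tm_copy:
  "i \<le> length w \<Longrightarrow>
    (step pad_tm ^^ i) (2, [(0, written w), (int (length v), written v)]) =
      (2, [(int i, written w), (int (length v + i), written (v @ take i w))])"
proof (induction i)
  case (Suc i)
  then show ?case
    using written_append_single[of "v @ take i w" "w ! i"]
    by (simp add: pad_tm_def pad_delta_def written_nth fun_upd_same take_Suc_conv_app_nth
        algebra_simps)
qed simp

lemma pad_tm_copied:
  "(step pad_tm ^^ Suc (length w)) (2, [(0, written w), (int (length v), written v)]) =
    (3, [(int (length w), written w), (int (length v + length w), written (v @ w))])"
  using pad_tm_copy[of "length w" w v] written_length[of "v @ w"]
  by (simp add: pad_tm_def pad_delta_def written_length fun_upd_same)

text \<open>Each of the three passes takes one step per input symbol and one for the blank that ends
  it.\<close>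

lemma pad_tm_halts_with: "halts_with pad_tm w (3 * Suc (length w)) (pad w)"
proof -
  define n where "n = Suc (length w)"
  define v where "v = replicate (length w) One @ [Sep]"
  have v: "int (length v) = int n"
    by (simp add: v_def n_def)
  have "(step pad_tm ^^ (3 * n)) (init pad_tm w) =
      (step pad_tm ^^ n) ((step pad_tm ^^ n) ((step pad_tm ^^ n) (init pad_tm w)))"
    by (simp add: funpow_add numeral_3_eq_3)
  also have "(step pad_tm ^^ n) (init pad_tm w) =
      (1, [(int (length w) - 1, written w), (int (length v), written v)])"
    using pad_tm_Sep[of w] unfolding v by (simp only: n_def v_def)
  also have "(step pad_tm ^^ n) \<dots> = (2, [(0, written w), (int (length v), written v)])"
    unfolding n_def by (rule pad_tm_rewound) (rule written_length)
  also have "(step pad_tm ^^ n) \<dots> =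
      (3, [(int (length w), written w), (int (length v + length w), written (v @ w))])"
    unfolding n_def by (rule pad_tm_copied)
  finally show ?thesis
    by (simp add: halts_with_def n_def v_def pad_def pad_tm_def)
qed

lemma polytime_computable_pad: "polytime_computable pad"
  unfolding polytime_computable_def
proof (intro exI conjI allI)
  show "wf_tm pad_tm"
    by (rule wf_pad_tm)
  show "3 * Suc (length w) \<le> poly [:3, 3:] (length w)" for w :: "symbol list"
    by simp
  show "halts_with pad_tm w (3 * Suc (length w)) (pad w)" for w
    by (rule pad_tm_halts_with)
qed

theorem theorem4:
  shows "RotDist \<le>\<^sub>p RotDist_H"
  unfolding polytime_many_one_reducible_def
  using polytime_computable_pad pad_in_RotDist_H in_RotDist_if_pad by blast

end
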